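(* Let $p\in(0,1)$ be a constant and $b=\frac{1}{1-p}$. Let $\beta:\mathbb{N}\to\mathbb{N}$ be a function with $\beta(n)\to\infty$ as $n\to\infty$, and for each $n$ let $H=H_n=([n],E)$ be a deterministic graph with $\chi(H)=\frac{n}{\beta(n)}$. Then for each $\varepsilon>0$, asymptotically almost surely $$\chi(\mathrm{pert}_{H,p})\le(1+\varepsilon)\cdot\frac{n\log(b)}{2(\log(n)-\log(\chi(H)))},$$ that is, the probability that this inequality holds tends to $1$ as $n\to\infty$.
   Context: $\mathcal{G}_{n,p}$ is the random graph on vertex set $[n]=\{1,\dots,n\}$ in which each pair of vertices is an edge independently with probability $p$. For a deterministic graph $H$ on $[n]$, the randomly augmented graph $\mathrm{pert}_{H,p}=H\cup\mathcal{G}_{n,p}$ is the graph on $[n]$ whose edge set is the union of the edge sets of $H$ and $\mathcal{G}_{n,p}$. $\chi(G)$ is the chromatic number of $G$. $\log$ is the natural logarithm. *)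

theory Defs
  imports "HOL-Probability.Probability" "HOL-Probability.Product_PMF"
begin

text \<open>A simple graph is given by its vertex set \<open>V\<close> and its edge set \<open>E\<close>, a set of
  two-element subsets of \<open>V\<close>.\<close>

definition vertex_pairs :: "'a set \<Rightarrow> 'a set set" where
  "vertex_pairs V = {e. e \<subseteq> V \<and> card e = 2}"

definition simple_graph :: "'a set \<Rightarrow> 'a set set \<Rightarrow> bool" where
  "simple_graph V E \<longleftrightarrow> E \<subseteq> vertex_pairs V"

definition proper_colouring :: "'a set \<Rightarrow> 'a set set \<Rightarrow> nat \<Rightarrow> ('a \<Rightarrow> nat) \<Rightarrow> bool" where
  "proper_colouring V E k c \<longleftrightarrow>
     (\<forall>v\<in>V. c v < k) \<and> (\<forall>u\<in>V. \<forall>v\<in>V. {u, v} \<in> E \<longrightarrow> c u \<noteq> c v)"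

text \<open>On a finite simple graph the minimum exists, since an injective colouring is proper.\<close>

definition chromatic_number :: "'a set \<Rightarrow> 'a set set \<Rightarrow> nat" where
  "chromatic_number V E = (LEAST k. \<exists>c. proper_colouring V E k c)"

text \<open>The distribution of the random edge set: the Boolean indicators of the pairs are
  independent Bernoulli variables with parameter \<open>p\<close>. The value \<open>False\<close> given to
  \<open>Pi_pmf\<close> is its dummy value outside the index set.\<close>

definition gnp :: "nat \<Rightarrow> real \<Rightarrow> nat set set pmf" where
  "gnp n p =
     map_pmf (\<lambda>X. {e \<in> vertex_pairs {1..n}. X e})
       (Pi_pmf (vertex_pairs {1..n}) False (\<lambda>_. bernoulli_pmf p))"

definition pert :: "nat \<Rightarrow> nat set set \<Rightarrow> real \<Rightarrow> nat set set pmf" where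
  "pert n H p = map_pmf (\<lambda>G. H \<union> G) (gnp n p)"

end

theory Submission
  imports Defs "HOL-Probability.Hoeffding" "HOL-Real_Asymp.Real_Asymp"
begin

text \<open>
  The graph \<open>H\<close> has a proper colouring with \<open>k = n / \<beta>\<close> classes, and no edge of \<open>H\<close> lies inside a
  class. Colouring each class with its own palette therefore reduces the claim to the chromatic
  numbers of the purely random graphs on the classes (\<open>colourable_union\<close>). A random graph on \<open>m\<close>
  vertices should need about \<open>m ln b / (2 ln m)\<close> colours, and the average class size is \<open>\<beta>\<close>, which is why
  \<open>ln n - ln (\<chi> H) = ln \<beta>\<close> appears. Classes much smaller than average, with fewer
  than \<open>\<beta> powr (1 - \<delta>)\<close> vertices, together contain at most \<open>n * \<beta> powr (- \<delta>)\<close> vertices, so they may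
  be coloured wastefully; for all other classes \<open>ln m \<ge> (1 - \<delta>) ln \<beta>\<close>.

  For a single random graph the upper bound is Bollobas' theorem. If every vertex subset of size
  about \<open>m / ln\<^sup>3 m\<close> contains an independent set of size \<open>s\<close> close to \<open>2 ln m / ln b\<close>, then removing such
  sets greedily uses about \<open>m / s\<close> colours (\<open>colourable_greedy\<close>). Since there may be
  \<open>2 ^ m\<close> subsets, a fixed subset must fail with probability far below \<open>2 powr (- m)\<close>. This is
  \<open>prob_no_independent_set\<close>. It rests on a Janson type inequality (\<open>prob_every_set_hit\<close>),
  which is derived from McDiarmid's bounded differences inequality, applied to a penalised count of
  independent sets that changes by at most 1 when a single edge changes, and on a second moment
  computation over transversals of a partition of the subset.

  When \<open>\<beta>\<close> grows slowly there are many classes, and some of them may be exceptional. The failure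
  probability of a class of size \<open>m\<close> is at most \<open>1 / m\<close>, so the expected number of vertices in
  failing classes is at most \<open>k = n / \<beta>\<close>. By Markov's inequality it is below
  \<open>n * \<beta> powr (- 1 / 2)\<close> with probability at least \<open>1 - \<beta> powr (- 1 / 2)\<close>
  (\<open>chromatic_number_augmented_tail\<close>); a failing class may then use one colour per vertex. All
  error terms are of smaller order than \<open>n / ln \<beta>\<close>.
\<close>

section \<open>Functions of independent coin flips with bounded differences\<close>

abbreviation coin_flips :: "'e set \<Rightarrow> real \<Rightarrow> ('e \<Rightarrow> bool) pmf" where
  "coin_flips E p \<equiv> Pi_pmf E False (\<lambda>_. bernoulli_pmf p)"

lemma finite_set_coin_flips: "finite E \<Longrightarrow> finite (set_pmf (coin_flips E p))"
  by (auto simp: set_Pi_pmf)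

lemma integrable_coin_flips [simp]:
  fixes f :: "('e \<Rightarrow> bool) \<Rightarrow> real"
  shows "finite E \<Longrightarrow> integrable (measure_pmf (coin_flips E p)) f"
  by (intro integrable_measure_pmf_finite finite_set_coin_flips)

lemma expectation_coin_flips_insert:
  fixes f :: "('e \<Rightarrow> bool) \<Rightarrow> real"
  assumes "finite E" "x \<notin> E" "0 \<le> p" "p \<le> 1"
  shows "measure_pmf.expectation (coin_flips (insert x E) p) f =
    p * measure_pmf.expectation (coin_flips E p) (\<lambda>X. f (X(x := True))) +
    (1 - p) * measure_pmf.expectation (coin_flips E p) (\<lambda>X. f (X(x := False)))"
proof -
  have eq: "coin_flips (insert x E) p =
      bernoulli_pmf p \<bind> (\<lambda>y. map_pmf (\<lambda>X. X(x := y)) (coin_flips E p))"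
    using assms by (subst Pi_pmf_insert') (auto simp: map_pmf_def)
  have "measure_pmf.expectation (coin_flips (insert x E) p) f =
     (\<Sum>y\<in>UNIV. pmf (bernoulli_pmf p) y *\<^sub>R
        measure_pmf.expectation (map_pmf (\<lambda>X. X(x := y)) (coin_flips E p)) f)"
    unfolding eq by (rule pmf_expectation_bind) (use assms finite_set_coin_flips[of E p] in auto)
  then show ?thesis using assms by (simp add: UNIV_bool)
qed

text \<open>
  Hoeffding's lemma for a variable with only the two values \<open>u\<close> and \<open>v\<close>. The analytic core
  covers a nonnegative exponent; exchanging the two values gives the other sign.
\<close>

lemma two_point_Hoeffding:
  fixes p u v l :: real
  assumes p: "0 \<le> p" "p \<le> 1" and uv: "\<bar>u - v\<bar> \<le> 1"
  defines "m \<equiv> p * u + (1 - p) * v"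
  shows "p * exp (l * (m - u)) + (1 - p) * exp (l * (m - v)) \<le> exp (l\<^sup>2 / 8)"
proof -
  have key: "q * exp ((1 - q) * h) + (1 - q) * exp (- q * h) \<le> exp (h\<^sup>2 / 8)"
    if "0 \<le> q" "q \<le> 1" "0 \<le> h" for q h :: real
  proof -
    have pos: "0 < 1 + q * (exp h - 1)"
      using that by (smt (verit) mult_nonneg_nonneg one_le_exp_iff)
    have "q * exp ((1 - q) * h) + (1 - q) * exp (- q * h) = exp (- h * q) * (1 + q * (exp h - 1))"
      by (simp add: algebra_simps exp_diff exp_minus field_simps)
    also have "\<dots> = exp (- h * q + ln (1 + q * (exp h - 1)))"
      using pos by (subst exp_add) simp
    also have "\<dots> \<le> exp (h\<^sup>2 / 8)"
      using Hoeffdings_lemma_aux[of h q] that by simp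
    finally show ?thesis .
  qed
  define d where "d = u - v"
  have mu: "l * (m - u) = (1 - p) * (- l * d)" and mv: "l * (m - v) = - p * (- l * d)"
    by (simp_all add: m_def d_def algebra_simps)
  have "p * exp (l * (m - u)) + (1 - p) * exp (l * (m - v)) \<le> exp ((l * d)\<^sup>2 / 8)"
  proof (cases "0 \<le> - l * d")
    case True
    from key[OF p True] show ?thesis unfolding mu mv by simp
  next
    case False
    then show ?thesis
      using key[of "1 - p" "l * d"] p unfolding mu mv by (simp add: algebra_simps)
  qed
  also have "(l * d)\<^sup>2 \<le> l\<^sup>2 * 1"
    using uv unfolding power_mult_distrib d_def by (intro mult_left_mono) (simp_all add: abs_square_le_1)
  finally show ?thesis by simp
qed

text \<open>
  McDiarmid's inequality, at the level of moment generating functions. Coins are exposed one at a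
  time. Once the first coin is fixed, the induction hypothesis controls the fluctuation of \<open>f\<close>
  around its conditional mean, and the two conditional means differ by at most 1, so that the first
  coin contributes one factor given by the two-point Hoeffding bound.
\<close>

lemma bounded_differences_mgf:
  fixes f :: "('e \<Rightarrow> bool) \<Rightarrow> real"
  assumes "finite E" and p: "0 \<le> p" "p \<le> 1"
    and "\<And>X e y z. e \<in> E \<Longrightarrow> f (X(e := y)) \<le> f (X(e := z)) + 1"
  shows "measure_pmf.expectation (coin_flips E p)
           (\<lambda>X. exp (l * (measure_pmf.expectation (coin_flips E p) f - f X)))
         \<le> exp (l\<^sup>2 * card E / 8)"
  using assms(1,4)
proof (induction E arbitrary: f)
  case empty
  then show ?case by simp
next
  case (insert x E)
  let ?E = "measure_pmf.expectation (coin_flips E p)"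
  define g where "g y X = f (X(x := y))" for y X
  define m where "m = p * ?E (g True) + (1 - p) * ?E (g False)"
  have IH: "?E (\<lambda>X. exp (l * (?E (g y) - g y X))) \<le> exp (l\<^sup>2 * card E / 8)" for y
  proof (rule insert.IH)
    fix X e b c assume e: "e \<in> E"
    then have "e \<noteq> x" using insert.hyps by auto
    then show "g y (X(e := b)) \<le> g y (X(e := c)) + 1"
      using insert.prems[of e "X(x := y)" b c] e
      unfolding g_def fun_upd_twist[OF \<open>e \<noteq> x\<close>] by blast
  qed
  have shift: "?E (\<lambda>X. exp (l * (m - g y X))) \<le> exp (l * (m - ?E (g y))) * exp (l\<^sup>2 * card E / 8)" for y
  proof -
    have "?E (\<lambda>X. exp (l * (m - g y X))) =
        ?E (\<lambda>X. exp (l * (m - ?E (g y))) * exp (l * (?E (g y) - g y X)))"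
      by (intro Bochner_Integration.integral_cong refl)
         (simp add: exp_add [symmetric] algebra_simps)
    also have "\<dots> = exp (l * (m - ?E (g y))) * ?E (\<lambda>X. exp (l * (?E (g y) - g y X)))"
      by simp
    finally show ?thesis using IH[of y] by simp
  qed
  have le: "?E (g y) \<le> ?E (g z) + 1" for y z
  proof -
    have "g y X \<le> g z X + 1" for X unfolding g_def by (rule insert.prems) simp
    then have "?E (g y) \<le> ?E (\<lambda>X. g z X + 1)"
      using insert.hyps by (intro integral_mono) simp_all
    then show ?thesis using insert.hyps by simp
  qed
  have "measure_pmf.expectation (coin_flips (insert x E) p)
           (\<lambda>X. exp (l * (measure_pmf.expectation (coin_flips (insert x E) p) f - f X)))
      = p * ?E (\<lambda>X. exp (l * (m - g True X))) + (1 - p) * ?E (\<lambda>X. exp (l * (m - g False X)))"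
    using insert.hyps p by (simp add: expectation_coin_flips_insert g_def[abs_def] m_def)
  also have "\<dots> \<le> p * (exp (l * (m - ?E (g True))) * exp (l\<^sup>2 * card E / 8))
      + (1 - p) * (exp (l * (m - ?E (g False))) * exp (l\<^sup>2 * card E / 8))"
    using p by (intro add_mono mult_left_mono shift) auto
  also have "\<dots> = (p * exp (l * (m - ?E (g True))) + (1 - p) * exp (l * (m - ?E (g False))))
      * exp (l\<^sup>2 * card E / 8)" by (simp add: algebra_simps)
  also have "\<dots> \<le> exp (l\<^sup>2 / 8) * exp (l\<^sup>2 * card E / 8)"
    unfolding m_def using le[of True False] le[of False True]
    by (intro mult_right_mono two_point_Hoeffding p) auto
  also have "\<dots> = exp (l\<^sup>2 * card (insert x E) / 8)"
    using insert.hyps by (simp add: exp_add [symmetric] field_simps)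
  finally show ?case .
qed

lemma bounded_differences_lower_tail:
  fixes f :: "('e \<Rightarrow> bool) \<Rightarrow> real"
  assumes E: "finite E" and p: "0 \<le> p" "p \<le> 1"
    and lip: "\<And>X e y z. e \<in> E \<Longrightarrow> f (X(e := y)) \<le> f (X(e := z)) + 1"
    and M: "M \<le> measure_pmf.expectation (coin_flips E p) f" "0 \<le> M"
  shows "measure_pmf.prob (coin_flips E p) {X. f X \<le> 0} \<le> exp (- 2 * M\<^sup>2 / card E)"
proof (cases "E = {}")
  case True
  then show ?thesis by simp
next
  case False
  then have c: "0 < real (card E)" using E by (simp add: card_gt_0_iff)
  let ?E = "measure_pmf.expectation (coin_flips E p)"
  \<comment> \<open>The minimiser of \<open>l\<^sup>2 * card E / 8 - l * M\<close>, the exponent in the Chernoff bound.\<close>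
  define l where "l = 4 * M / card E"
  have l0: "0 \<le> l" using M c by (simp add: l_def)
  have "measure_pmf.prob (coin_flips E p) {X. f X \<le> 0} = ?E (indicator {X. f X \<le> 0})"
    by simp
  also have "\<dots> \<le> ?E (\<lambda>X. exp (l * (?E f - f X)) * exp (- l * M))"
  proof (intro integral_mono)
    fix X
    show "indicator {X. f X \<le> 0} X \<le> exp (l * (?E f - f X)) * exp (- l * M)"
    proof (cases "f X \<le> 0")
      case True
      have "0 \<le> l * (?E f - f X - M)" using l0 M True by (intro mult_nonneg_nonneg) auto
      then have "0 \<le> l * (?E f - f X) + - l * M" by (simp add: algebra_simps)
      then show ?thesis unfolding exp_add[symmetric] using True by simp
    qed simp
  qed (use E in simp_all)
  also have "\<dots> = ?E (\<lambda>X. exp (l * (?E f - f X))) * exp (- l * M)"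
    by simp
  also have "\<dots> \<le> exp (l\<^sup>2 * card E / 8) * exp (- l * M)"
    by (intro mult_right_mono bounded_differences_mgf E p lip) auto
  also have "\<dots> = exp (- 2 * M\<^sup>2 / card E)"
    unfolding exp_add[symmetric] l_def using c
    by (simp add: power2_eq_square field_simps)
  finally show ?thesis .
qed

section \<open>A Janson type inequality\<close>

lemma prob_all_tails:
  assumes "finite E" "A \<subseteq> E" "0 \<le> p" "p \<le> 1"
  shows "measure_pmf.prob (coin_flips E p) {X. \<forall>e\<in>A. \<not> X e} = (1 - p) ^ card A"
proof -
  have "{X. \<forall>e\<in>A. \<not> X e} = Pi E (\<lambda>e. if e \<in> A then {False} else UNIV)"
    using assms(2) by (auto simp: Pi_def split: if_splits)
  then have "measure_pmf.prob (coin_flips E p) {X. \<forall>e\<in>A. \<not> X e} =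
      (\<Prod>e\<in>E. measure_pmf.prob (bernoulli_pmf p) (if e \<in> A then {False} else UNIV))"
    using assms(1) by (simp add: measure_Pi_pmf_Pi)
  also have "\<dots> = (\<Prod>e\<in>E. if e \<in> A then 1 - p else 1)"
    using assms by (intro prod.cong) (auto simp: measure_pmf_single)
  also have "\<dots> = (1 - p) ^ card A"
    using assms by (simp add: prod.If_cases Int_absorb1)
  finally show ?thesis .
qed

text \<open>
  A bound of Janson type for the event that no \<open>A i\<close> consists of tails only. Here \<open>\<mu>\<close> is the
  expected number of all-tails sets and \<open>D\<close> the expected number of ordered pairs of them that
  share a coin. Applying a lower tail bound to the number of all-tails sets itself would be useless,
  because one coin may affect very many of them. The random variable \<open>Z\<close> below repairs this: it
  is the largest value of \<open>2 t \<bar>S\<bar> - t\<^sup>2 \<bar>{(i, j) \<in> S \<times> S. A i \<inter> A j \<noteq> {}}\<bar>\<close> over families \<open>S\<close>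
  of all-tails sets. When a coin turns to heads, the \<open>x\<close> members of an optimal \<open>S\<close> containing it
  are discarded; they pairwise share that coin, so the loss is at most
  \<open>2 t x - t\<^sup>2 x\<^sup>2 \<le> 1\<close>. Hence \<open>Z\<close> has bounded differences, it vanishes if there is no all-tails
  set, and choosing \<open>S\<close> to be all of them shows that its mean is at least
  \<open>2 t \<mu> - t\<^sup>2 D\<close>, which is \<open>\<mu>\<^sup>2 / D\<close> for the best \<open>t\<close>.
\<close>

lemma prob_every_set_hit:
  fixes A :: "'i \<Rightarrow> 'e set"
  assumes E: "finite E" and p: "0 \<le> p" "p \<le> 1" and I: "finite I"
    and A: "\<And>i. i \<in> I \<Longrightarrow> A i \<subseteq> E" "\<And>i. i \<in> I \<Longrightarrow> A i \<noteq> {}"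
  defines "\<mu> \<equiv> \<Sum>i\<in>I. (1 - p) ^ card (A i)"
    and "D \<equiv> \<Sum>(i,j) | i \<in> I \<and> j \<in> I \<and> A i \<inter> A j \<noteq> {}. (1 - p) ^ card (A i \<union> A j)"
  assumes D: "0 < D"
  shows "measure_pmf.prob (coin_flips E p) {X. \<forall>i\<in>I. \<exists>e\<in>A i. X e}
           \<le> exp (- 2 * (\<mu>\<^sup>2 / D)\<^sup>2 / card E)"
proof -
  let ?E = "measure_pmf.expectation (coin_flips E p)"
  define C where "C S = {(i, j). i \<in> S \<and> j \<in> S \<and> A i \<inter> A j \<noteq> {}}" for S
  define un where "un X = {i \<in> I. \<forall>e\<in>A i. \<not> X e}" for X
  define t where "t = \<mu> / D"
  define val where "val S = 2 * t * real (card S) - t\<^sup>2 * real (card (C S))" for S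
  define Z where "Z X = Max (val ` Pow (un X))" for X
  have fin_un: "finite (un X)" for X using I by (simp add: un_def)
  have fin_C: "finite (C S)" if "finite S" for S
    using that by (rule_tac finite_subset[of _ "S \<times> S"]) (auto simp: C_def)
  have Z_ge: "val S \<le> Z X" if "S \<subseteq> un X" for S X
    unfolding Z_def using that fin_un[of X] by (intro Max_ge) auto
  have lip: "Z (X(e := y)) \<le> Z (X(e := z)) + 1" for X e y z
  proof -
    have "Z (X(e := y)) \<in> val ` Pow (un (X(e := y)))"
      unfolding Z_def using fin_un by (intro Max_in) auto
    then obtain S where S: "S \<subseteq> un (X(e := y))" "Z (X(e := y)) = val S" by auto
    have finS: "finite S" using S(1) fin_un finite_subset by blast
    \<comment> \<open>The members of an optimal family that are lost if coin \<open>e\<close> turns to heads.\<close>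
    define R where "R = {i \<in> S. e \<in> A i}"
    define S' where "S' = S - R"
    have "S' \<subseteq> un (X(e := z))" using S(1) by (fastforce simp: S'_def R_def un_def split: if_splits)
    then have ge: "val S' \<le> Z (X(e := z))" by (rule Z_ge)
    have "R \<subseteq> S" by (auto simp: R_def)
    then have card_S: "real (card S) = real (card S') + real (card R)"
      using finS by (simp add: S'_def card_Diff_subset finite_subset card_mono)
    have "R \<times> R \<union> C S' \<subseteq> C S" by (auto simp: C_def R_def S'_def)
    then have "card (R \<times> R \<union> C S') \<le> card (C S)" by (intro card_mono fin_C finS)
    also have "card (R \<times> R \<union> C S') = card (R \<times> R) + card (C S')"
    proof (rule card_Un_disjoint)
      show "finite (R \<times> R)" "finite (C S')" using finS by (auto simp: R_def S'_def intro!: fin_C)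
      show "(R \<times> R) \<inter> C S' = {}" by (auto simp: R_def S'_def C_def)
    qed
    finally have "card R * card R + card (C S') \<le> card (C S)" by (simp add: card_cartesian_product)
    then have card_C: "real (card R) * real (card R) + real (card (C S')) \<le> real (card (C S))"
      by (metis of_nat_add of_nat_le_iff of_nat_mult)
    have "val S \<le> 2 * t * (real (card S') + real (card R)) -
        t\<^sup>2 * (real (card R) * real (card R) + real (card (C S')))"
      unfolding val_def card_S using card_C by (intro diff_left_mono mult_left_mono) auto
    also have "\<dots> = val S' + 1 - (1 - t * card R)\<^sup>2"
      by (simp add: val_def algebra_simps power2_eq_square)
    also have "\<dots> \<le> val S' + 1" by simp
    finally show ?thesis using S(2) ge by linarith
  qed
  have mean: "\<mu>\<^sup>2 / D \<le> ?E Z"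
  proof -
    define J where "J = C I"
    have finJ: "finite J" using fin_C I by (simp add: J_def)
    have card1: "real (card (un X)) = (\<Sum>i\<in>I. indicator {X. \<forall>e\<in>A i. \<not> X e} X)" for X
    proof -
      have "un X = {i \<in> I. X \<in> {X. \<forall>e\<in>A i. \<not> X e}}" by (auto simp: un_def)
      then show ?thesis using I by (simp add: indicator_def of_bool_def sum.If_cases Int_def)
    qed
    have card2: "real (card (C (un X))) = (\<Sum>(i,j)\<in>J. indicator {X. \<forall>e\<in>A i \<union> A j. \<not> X e} X)" for X
    proof -
      have "C (un X) = {ij \<in> J. X \<in> {X. \<forall>e\<in>A (fst ij) \<union> A (snd ij). \<not> X e}}"
        by (auto simp: un_def J_def C_def)
      then show ?thesis using finJ
        by (simp add: indicator_def of_bool_def sum.If_cases Int_def case_prod_beta)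
    qed
    have E1: "?E (\<lambda>X. real (card (un X))) = \<mu>"
      unfolding card1 \<mu>_def using E A p by (simp add: prob_all_tails)
    have E2: "?E (\<lambda>X. real (card (C (un X)))) = D"
    proof -
      have "?E (\<lambda>X. real (card (C (un X)))) =
          (\<Sum>(i,j)\<in>J. measure_pmf.prob (coin_flips E p) {X. \<forall>e\<in>A i \<union> A j. \<not> X e})"
        unfolding card2 using E by (simp add: case_prod_beta)
      also have "\<dots> = (\<Sum>(i,j)\<in>J. (1 - p) ^ card (A i \<union> A j))"
        using A E p by (intro sum.cong refl) (auto simp: J_def C_def intro!: prob_all_tails)
      finally show ?thesis by (simp add: D_def J_def C_def)
    qed
    have "\<mu>\<^sup>2 / D = 2 * t * \<mu> - t\<^sup>2 * D"
      using D by (simp add: t_def power2_eq_square field_simps)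
    also have "\<dots> = ?E (\<lambda>X. val (un X))"
      unfolding val_def using E by (simp add: E1 E2)
    also have "\<dots> \<le> ?E Z"
      using E by (intro integral_mono Z_ge) auto
    finally show ?thesis .
  qed
  have "{X. \<forall>i\<in>I. \<exists>e\<in>A i. X e} \<subseteq> {X. Z X \<le> 0}"
  proof safe
    fix X assume "\<forall>i\<in>I. \<exists>e\<in>A i. X e"
    then have "un X = {}" by (auto simp: un_def)
    then show "Z X \<le> 0" by (simp add: Z_def val_def C_def)
  qed
  then have "measure_pmf.prob (coin_flips E p) {X. \<forall>i\<in>I. \<exists>e\<in>A i. X e}
      \<le> measure_pmf.prob (coin_flips E p) {X. Z X \<le> 0}"
    by (intro measure_pmf.finite_measure_mono) auto
  also have "\<dots> \<le> exp (- 2 * (\<mu>\<^sup>2 / D)\<^sup>2 / card E)"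
    using mean D by (intro bounded_differences_lower_tail E p lip) auto
  finally show ?thesis .
qed

section \<open>Independent transversals in the random graph\<close>

lemma card_vertex_pairs: "finite V \<Longrightarrow> card (vertex_pairs V) = card V choose 2"
  unfolding vertex_pairs_def by (rule n_subsets)

lemma finite_vertex_pairs [simp]: "finite V \<Longrightarrow> finite (vertex_pairs V)"
  unfolding vertex_pairs_def by simp

lemma vertex_pairs_mono: "U \<subseteq> V \<Longrightarrow> vertex_pairs U \<subseteq> vertex_pairs V"
  unfolding vertex_pairs_def by auto

lemma vertex_pairs_Int: "vertex_pairs U \<inter> vertex_pairs V = vertex_pairs (U \<inter> V)"
  unfolding vertex_pairs_def by auto

lemma vertex_pairs_nonempty_iff:
  assumes "finite V" shows "vertex_pairs V \<noteq> {} \<longleftrightarrow> 2 \<le> card V"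
proof -
  have "vertex_pairs V \<noteq> {} \<longleftrightarrow> 0 < card V choose 2"
    using assms by (simp add: card_vertex_pairs[symmetric] card_gt_0_iff)
  then show ?thesis by (simp add: zero_less_binomial_iff)
qed

lemma two_times_choose_two: "2 * (n choose 2) = n * (n - 1)"
  by (cases n) (simp_all add: choose_two)

text \<open>
  Grouping the functions \<open>g\<close> by the set \<open>J\<close> on which they agree with the fixed \<open>f\<close>: given \<open>J\<close>,
  only the values of \<open>g\<close> outside \<open>J\<close> are free.
\<close>

lemma sum_over_agreement_sets:
  fixes w :: "nat \<Rightarrow> real"
  assumes w: "\<And>j. 0 \<le> w j" and S: "finite S" and Q: "finite Q" and f: "f \<in> S \<rightarrow>\<^sub>E Q"
  shows "(\<Sum>g | g \<in> S \<rightarrow>\<^sub>E Q \<and> 2 \<le> card {i\<in>S. f i = g i}. w (card {i\<in>S. f i = g i}))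
    \<le> (\<Sum>J | J \<subseteq> S \<and> 2 \<le> card J. real (card Q) ^ (card S - card J) * w (card J))"
proof -
  let ?G = "{g \<in> S \<rightarrow>\<^sub>E Q. 2 \<le> card {i\<in>S. f i = g i}}"
  let ?J = "{J. J \<subseteq> S \<and> 2 \<le> card J}"
  have finG: "finite ?G" using S Q by (simp add: finite_PiE)
  have finJ: "finite ?J" using S by simp
  have count: "card {g \<in> ?G. {i\<in>S. f i = g i} = J} \<le> card Q ^ (card S - card J)" if "J \<in> ?J" for J
  proof -
    have J: "J \<subseteq> S" using that by simp
    have "{g \<in> ?G. {i\<in>S. f i = g i} = J} \<subseteq> Pi\<^sub>E S (\<lambda>i. if i \<in> J then {f i} else Q)"
      by (auto simp: PiE_iff extensional_def split: if_splits)
    then have "card {g \<in> ?G. {i\<in>S. f i = g i} = J} \<le> card (Pi\<^sub>E S (\<lambda>i. if i \<in> J then {f i} else Q))"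
      using S Q by (intro card_mono finite_PiE) auto
    also have "\<dots> = (\<Prod>i\<in>S. if i \<in> J then 1 else card Q)"
      using S by (subst card_PiE) (auto intro!: prod.cong)
    also have "\<dots> = card Q ^ card (S \<inter> - J)"
      using S by (simp add: prod.If_cases)
    also have "card (S \<inter> - J) = card S - card J"
      using J S by (simp add: Diff_eq[symmetric] card_Diff_subset finite_subset)
    finally show ?thesis .
  qed
  have "(\<Sum>g\<in>?G. w (card {i\<in>S. f i = g i})) =
     (\<Sum>J\<in>?J. \<Sum>g | g \<in> ?G \<and> {i\<in>S. f i = g i} = J. w (card {i\<in>S. f i = g i}))"
    by (rule sum.group[symmetric]) (use finG finJ in auto)
  also have "\<dots> = (\<Sum>J\<in>?J. real (card {g \<in> ?G. {i\<in>S. f i = g i} = J}) * w (card J))"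
    by (intro sum.cong refl) simp
  also have "\<dots> \<le> (\<Sum>J\<in>?J. real (card Q ^ (card S - card J)) * w (card J))"
    by (intro sum_mono mult_right_mono w) (use count of_nat_le_iff in blast)
  finally show ?thesis by simp
qed

lemma sum_subsets_by_card:
  fixes h :: "nat \<Rightarrow> real"
  assumes "finite S"
  shows "(\<Sum>J | J \<subseteq> S \<and> 2 \<le> card J. h (card J)) = (\<Sum>j = 2..card S. real (card S choose j) * h j)"
proof -
  let ?J = "{J. J \<subseteq> S \<and> 2 \<le> card J}"
  have "(\<Sum>J\<in>?J. h (card J)) = (\<Sum>j = 2..card S. \<Sum>J | J \<in> ?J \<and> card J = j. h (card J))"
    by (rule sum.group[symmetric]) (use assms in \<open>auto intro: card_mono\<close>)
  also have "\<dots> = (\<Sum>j = 2..card S. real (card S choose j) * h j)"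
  proof (intro sum.cong refl)
    fix j assume j: "j \<in> {2..card S}"
    have "{J \<in> ?J. card J = j} = {J. J \<subseteq> S \<and> card J = j}" using j by auto
    then show "(\<Sum>J | J \<in> ?J \<and> card J = j. h (card J)) = real (card S choose j) * h j"
      using assms by (simp add: n_subsets)
  qed
  finally show ?thesis .
qed

text \<open>
  The summands have the form \<open>exp (quadratic in j)\<close>, a convex exponent, so only the two ends of the
  range matter. Comparing \<open>j (j - 1) / 2\<close> with the linear function \<open>1 + (j - 2) (s + 1) / 2\<close> of
  \<open>j\<close>, which dominates it for \<open>2 \<le> j \<le> s\<close>, turns this into a geometric series whose first
  summand \<open>j = 2\<close> carries the main weight.
\<close>

lemma agreement_series_bound:
  fixes c :: real
  assumes c: "1 \<le> c" and q: "0 < q" and small: "real s / real q * c ^ (s + 1) \<le> 1 / 2"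
  shows "(\<Sum>j = 2..s. real (s choose j) * (real q ^ (s - j) * (c\<^sup>2) ^ (j choose 2)))
    \<le> real q ^ s * (2 * c\<^sup>2 * (real s / real q)\<^sup>2)"
proof -
  define x where "x = real s / real q * c ^ (s + 1)"
  have x: "0 \<le> x" "x \<le> 1 / 2" using small c by (simp_all add: x_def)
  have summand: "real (s choose j) * (real q ^ (s - j) * (c\<^sup>2) ^ (j choose 2))
      \<le> real q ^ s * (c\<^sup>2 * (real s / real q)\<^sup>2) * x ^ (j - 2)" if j: "j \<in> {2..s}" for j
  proof -
    obtain i where i: "j = i + 2" using j by (metis atLeastAtMost_iff le_add_diff_inverse2)
    have "2 * (j choose 2) \<le> 2 + (s + 1) * i"
    proof -
      have "2 * (j choose 2) = 2 + i * (i + 3)" by (simp add: two_times_choose_two i algebra_simps)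
      also have "\<dots> \<le> 2 + i * (s + 1)" using j i by (intro add_left_mono mult_le_mono2) auto
      finally show ?thesis by (simp add: mult.commute)
    qed
    then have "c ^ (2 * (j choose 2)) \<le> c ^ (2 + (s + 1) * i)"
      using c by (intro power_increasing)
    then have A: "(c\<^sup>2) ^ (j choose 2) \<le> c\<^sup>2 * (c ^ (s + 1)) ^ i"
      by (simp only: power_mult[of c 2] power_add[of c 2] power_mult[of c "s + 1"])
    have B: "real (s choose j) \<le> real s ^ j"
      using binomial_le_pow[of j s] j of_nat_le_iff[of "s choose j" "s ^ j"] by simp
    have "real (s choose j) * (real q ^ (s - j) * (c\<^sup>2) ^ (j choose 2))
        \<le> real s ^ j * (real q ^ (s - j) * (c\<^sup>2 * (c ^ (s + 1)) ^ i))"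
      using A B by (intro mult_mono) auto
    also have "\<dots> = real s ^ j * (real q ^ s / real q ^ j * (c\<^sup>2 * (c ^ (s + 1)) ^ i))"
      using q j by (simp add: power_diff)
    also have "\<dots> = real q ^ s * (c\<^sup>2 * (real s / real q)\<^sup>2) * x ^ (j - 2)"
      by (simp add: x_def i power_add power_divide power_mult_distrib power2_eq_square mult_ac)
    finally show ?thesis .
  qed
  have "(\<Sum>j = 2..s. real (s choose j) * (real q ^ (s - j) * (c\<^sup>2) ^ (j choose 2)))
     \<le> (\<Sum>j = 2..s. real q ^ s * (c\<^sup>2 * (real s / real q)\<^sup>2) * x ^ (j - 2))"
    by (intro sum_mono summand)
  also have "\<dots> = real q ^ s * (c\<^sup>2 * (real s / real q)\<^sup>2) * (\<Sum>j = 2..s. x ^ (j - 2))"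
    by (simp add: sum_distrib_left)
  also have "\<dots> \<le> real q ^ s * (c\<^sup>2 * (real s / real q)\<^sup>2) * 2"
  proof (intro mult_left_mono)
    have "(\<Sum>j = 2..s. x ^ (j - 2)) = (\<Sum>i\<in>{..<s - 1}. x ^ i)"
      by (rule sum.reindex_bij_witness[of _ "\<lambda>i. i + 2" "\<lambda>j. j - 2"]) auto
    also have "\<dots> \<le> (\<Sum>i. x ^ i)"
      using x by (intro sum_le_suminf summable_geometric) auto
    also have "\<dots> = 1 / (1 - x)" using x by (intro suminf_geometric) auto
    also have "\<dots> \<le> 2" using x by (simp add: field_simps)
    finally show "(\<Sum>j = 2..s. x ^ (j - 2)) \<le> 2" .
  qed simp
  finally show ?thesis by (simp add: algebra_simps)
qed

text \<open>
  The vertex set is cut into \<open>s\<close> groups of size \<open>q\<close>, and only the \<open>q ^ s\<close> transversals, one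
  vertex from each group, are tried as independent sets. This family is large enough, and
  two of its members are described by two functions \<open>f, g : [s] \<rightarrow> [q]\<close> that agree in
  independent coordinates, which makes the second moment a plain sum over agreement sets. With
  \<open>c\<^sup>2 = 1 / (1 - p)\<close> that sum gives \<open>D \<le> \<mu>\<^sup>2 * 2 c\<^sup>2 s\<^sup>2 / q\<^sup>2\<close> for the quantities of the
  Janson type bound. The smallness hypothesis says that \<open>s\<close> stays safely below twice the
  logarithm of \<open>q\<close> to base \<open>1 / (1 - p)\<close>, the size at which independent sets disappear.
\<close>

lemma prob_no_independent_set:
  fixes U :: "'a set"
  assumes U: "finite U" "card U = s * q" and s: "2 \<le> s" and q: "0 < q"
    and p: "0 < p" "p < 1" and c: "c = 1 / sqrt (1 - p)"
    and small: "real s / real q * c ^ (s + 1) \<le> 1 / 2"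
  shows "measure_pmf.prob (coin_flips (vertex_pairs U) p)
           {X. \<forall>I \<subseteq> U. card I = s \<longrightarrow> (\<exists>e\<in>vertex_pairs I. X e)}
         \<le> exp (- (real q)\<^sup>2 / (c ^ 4 * real s ^ 6))"
proof -
  define r where "r = 1 - p"
  have r: "0 < r" "r < 1" and c2: "c\<^sup>2 = 1 / r" using p by (simp_all add: r_def c power_divide)
  have c1: "1 \<le> c" using p by (simp add: c)
  obtain \<phi> where \<phi>: "bij_betw \<phi> ({..<s} \<times> {..<q}) U"
    using finite_same_card_bij[of "{..<s} \<times> {..<q}" U] U by (auto simp: card_cartesian_product)
  define F where "F = {..<s} \<rightarrow>\<^sub>E {..<q}"
  define T where "T f = (\<lambda>i. \<phi> (i, f i)) ` {..<s}" for f
  define agree where "agree f g = {i\<in>{..<s}. f i = g i}" for f g :: "nat \<Rightarrow> nat"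
  let ?A = "\<lambda>f. vertex_pairs (T f)"
  have finF: "finite F" and cardF: "card F = q ^ s"
    by (simp_all add: F_def finite_PiE card_funcsetE)
  have inj: "\<phi> (i, f i) = \<phi> (k, g k) \<longleftrightarrow> i = k \<and> f i = g k"
    if "f \<in> F" "g \<in> F" "i < s" "k < s" for f g i k
    using that inj_onD[OF bij_betw_imp_inj_on[OF \<phi>], of "(i, f i)" "(k, g k)"]
    by (auto simp: F_def PiE_iff)
  have TU: "T f \<subseteq> U" if "f \<in> F" for f
    using that bij_betw_imp_surj_on[OF \<phi>] by (auto simp: T_def F_def PiE_iff)
  have fin_T: "finite (T f)" for f by (simp add: T_def)
  have card_T: "card (T f) = s" if "f \<in> F" for f
    using that unfolding T_def by (subst card_image) (auto simp: inj_on_def inj)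
  have T_Int: "card (T f \<inter> T g) = card (agree f g)" if "f \<in> F" "g \<in> F" for f g
  proof -
    have "T f \<inter> T g = (\<lambda>i. \<phi> (i, f i)) ` agree f g"
      using that by (auto simp: T_def agree_def inj image_iff)
    moreover have "inj_on (\<lambda>i. \<phi> (i, f i)) (agree f g)"
      using that by (auto simp: inj_on_def inj agree_def)
    ultimately show ?thesis by (simp add: card_image)
  qed
  have A_Int: "?A f \<inter> ?A g \<noteq> {} \<longleftrightarrow> 2 \<le> card (agree f g)" if "f \<in> F" "g \<in> F" for f g
    using vertex_pairs_nonempty_iff[of "T f \<inter> T g"] fin_T[of f] T_Int[OF that]
    by (simp add: vertex_pairs_Int)
  \<comment> \<open>Two transversals agreeing in \<open>j\<close> coordinates share exactly the \<open>j choose 2\<close> pairs inside their intersection.\<close>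
  have A_Un: "r ^ card (?A f \<union> ?A g) = (r ^ (s choose 2))\<^sup>2 * (c\<^sup>2) ^ (card (agree f g) choose 2)"
    if "f \<in> F" "g \<in> F" for f g
  proof -
    have "card (?A f) + card (?A g) = card (?A f \<union> ?A g) + card (?A f \<inter> ?A g)"
      using fin_T by (intro card_Un_Int) auto
    then have "(s choose 2) + (s choose 2) = card (?A f \<union> ?A g) + (card (agree f g) choose 2)"
      using that fin_T by (simp add: vertex_pairs_Int card_vertex_pairs card_T T_Int)
    then have "r ^ (s choose 2) * r ^ (s choose 2) = r ^ card (?A f \<union> ?A g) * r ^ (card (agree f g) choose 2)"
      by (simp only: power_add[symmetric])
    moreover have "r ^ n * (c\<^sup>2) ^ n = 1" for n
      using r by (simp add: c2 power_mult_distrib[symmetric])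
    ultimately show ?thesis by (simp add: power2_eq_square[of "r ^ _"])
  qed
  define \<mu> where "\<mu> = (\<Sum>f\<in>F. r ^ card (?A f))"
  define D where "D = (\<Sum>(f,g) | f \<in> F \<and> g \<in> F \<and> ?A f \<inter> ?A g \<noteq> {}. r ^ card (?A f \<union> ?A g))"
  have \<mu>: "\<mu> = real q ^ s * r ^ (s choose 2)"
    using cardF fin_T by (simp add: \<mu>_def card_vertex_pairs card_T)
  have \<mu>0: "0 < \<mu>" using q r by (simp add: \<mu>)
  have D_eq: "D = (\<Sum>f\<in>F. \<Sum>g | g \<in> F \<and> 2 \<le> card (agree f g).
      (r ^ (s choose 2))\<^sup>2 * (c\<^sup>2) ^ (card (agree f g) choose 2))"
  proof -
    have "{(f, g). f \<in> F \<and> g \<in> F \<and> ?A f \<inter> ?A g \<noteq> {}} = (SIGMA f:F. {g \<in> F. 2 \<le> card (agree f g)})"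
      using A_Int by blast
    then have "D = (\<Sum>(f,g)\<in>(SIGMA f:F. {g \<in> F. 2 \<le> card (agree f g)}). r ^ card (?A f \<union> ?A g))"
      by (simp add: D_def)
    also have "\<dots> = (\<Sum>f\<in>F. \<Sum>g | g \<in> F \<and> 2 \<le> card (agree f g). r ^ card (?A f \<union> ?A g))"
      using finF by (subst sum.Sigma) auto
    finally show ?thesis by (simp add: A_Un)
  qed
  have D_le: "D \<le> \<mu>\<^sup>2 * (2 * c\<^sup>2 * (real s / real q)\<^sup>2)"
  proof -
    have "D = (r ^ (s choose 2))\<^sup>2 * (\<Sum>f\<in>F. \<Sum>g | g \<in> F \<and> 2 \<le> card (agree f g).
        (c\<^sup>2) ^ (card (agree f g) choose 2))"
      by (simp add: D_eq sum_distrib_left)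
    also have "\<dots> \<le> (r ^ (s choose 2))\<^sup>2 * (\<Sum>f\<in>F. real q ^ s * (2 * c\<^sup>2 * (real s / real q)\<^sup>2))"
    proof (intro mult_left_mono sum_mono)
      fix f assume f: "f \<in> F"
      have "(\<Sum>g | g \<in> F \<and> 2 \<le> card (agree f g). (c\<^sup>2) ^ (card (agree f g) choose 2))
        \<le> (\<Sum>J | J \<subseteq> {..<s} \<and> 2 \<le> card J. real q ^ (s - card J) * (c\<^sup>2) ^ (card J choose 2))"
        using sum_over_agreement_sets[of "\<lambda>j. (c\<^sup>2) ^ (j choose 2)" "{..<s}" "{..<q}" f] f
        by (simp add: F_def agree_def)
      also have "\<dots> = (\<Sum>j = 2..s. real (s choose j) * (real q ^ (s - j) * (c\<^sup>2) ^ (j choose 2)))"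
        by (subst sum_subsets_by_card) simp_all
      also have "\<dots> \<le> real q ^ s * (2 * c\<^sup>2 * (real s / real q)\<^sup>2)"
        by (intro agreement_series_bound c1 q small)
      finally show "(\<Sum>g | g \<in> F \<and> 2 \<le> card (agree f g). (c\<^sup>2) ^ (card (agree f g) choose 2))
        \<le> real q ^ s * (2 * c\<^sup>2 * (real s / real q)\<^sup>2)" .
    qed simp
    also have "\<dots> = \<mu>\<^sup>2 * (2 * c\<^sup>2 * (real s / real q)\<^sup>2)"
      by (simp add: cardF \<mu> power2_eq_square)
    finally show ?thesis .
  qed
  have D0: "0 < D"
  proof -
    obtain f where f: "f \<in> F" using cardF q by (metis card.empty ex_in_conv power_eq_0_iff less_irrefl)
    have "{(f, g). f \<in> F \<and> g \<in> F \<and> ?A f \<inter> ?A g \<noteq> {}} \<subseteq> F \<times> F" by auto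
    then have fin: "finite {(f, g). f \<in> F \<and> g \<in> F \<and> ?A f \<inter> ?A g \<noteq> {}}"
      by (rule finite_subset) (simp add: finF)
    have "agree f f = {..<s}" by (auto simp: agree_def)
    then have "?A f \<inter> ?A f \<noteq> {}" using f s by (simp only: A_Int) simp
    then have "(f, f) \<in> {(f, g). f \<in> F \<and> g \<in> F \<and> ?A f \<inter> ?A g \<noteq> {}}"
      using f by simp
    then show ?thesis unfolding D_def using r by (intro sum_pos2[OF fin]) auto
  qed
  have ratio: "(real q)\<^sup>2 / (2 * c\<^sup>2 * (real s)\<^sup>2) \<le> \<mu>\<^sup>2 / D"
  proof -
    have "\<mu>\<^sup>2 / (\<mu>\<^sup>2 * (2 * c\<^sup>2 * (real s / real q)\<^sup>2)) \<le> \<mu>\<^sup>2 / D"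
      using D_le D0 by (intro divide_left_mono) (auto intro!: mult_pos_pos simp: \<mu>0 less_le_trans[OF D0 D_le])
    also have "\<mu>\<^sup>2 / (\<mu>\<^sup>2 * (2 * c\<^sup>2 * (real s / real q)\<^sup>2)) = (real q)\<^sup>2 / (2 * c\<^sup>2 * (real s)\<^sup>2)"
      using \<mu>0 q by (simp add: power_divide)
    finally show ?thesis .
  qed
  let ?E = "vertex_pairs U"
  have cardE: "2 * real (card ?E) \<le> (real s * real q)\<^sup>2"
  proof -
    have "2 * card ?E \<le> (s * q) * (s * q)"
      using U by (simp add: card_vertex_pairs two_times_choose_two)
    then show ?thesis unfolding power2_eq_square by (metis of_nat_le_iff of_nat_mult of_nat_numeral)
  qed
  have cardE0: "0 < real (card ?E)"
  proof -
    have "2 \<le> s * q" using s q by (metis mult_le_mono mult_1_right Suc_leI One_nat_def)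
    then have "?E \<noteq> {}" using vertex_pairs_nonempty_iff[OF U(1)] U(2) by simp
    then show ?thesis using U(1) by (simp add: card_gt_0_iff)
  qed
  have "measure_pmf.prob (coin_flips ?E p) {X. \<forall>I \<subseteq> U. card I = s \<longrightarrow> (\<exists>e\<in>vertex_pairs I. X e)}
      \<le> measure_pmf.prob (coin_flips ?E p) {X. \<forall>f\<in>F. \<exists>e\<in>?A f. X e}"
    using TU card_T by (intro measure_pmf.finite_measure_mono) auto
  also have "\<dots> \<le> exp (- 2 * (\<mu>\<^sup>2 / D)\<^sup>2 / card ?E)"
    unfolding \<mu>_def D_def r_def
  proof (rule prob_every_set_hit)
    show "?A f \<subseteq> ?E" if "f \<in> F" for f using TU[OF that] by (rule vertex_pairs_mono)
    show "?A f \<noteq> {}" if "f \<in> F" for f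
      using card_T[OF that] fin_T[of f] s by (simp only: vertex_pairs_nonempty_iff)
  qed (use U p finF D0 in \<open>simp_all add: D_def r_def\<close>)
  also have "\<dots> \<le> exp (- (real q)\<^sup>2 / (c ^ 4 * real s ^ 6))"
  proof -
    have "(real q)\<^sup>2 / (c ^ 4 * real s ^ 6)
       = 2 * ((real q)\<^sup>2 / (2 * c\<^sup>2 * (real s)\<^sup>2))\<^sup>2 / ((real s * real q)\<^sup>2 / 2)"
      using q s c1 by (simp add: power2_eq_square field_simps eval_nat_numeral)
    also have "\<dots> \<le> 2 * (\<mu>\<^sup>2 / D)\<^sup>2 / real (card ?E)"
      using cardE cardE0 by (intro frac_le mult_left_mono power_mono[OF ratio]) auto
    finally show ?thesis by simp
  qed
  finally show ?thesis .
qed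

text \<open>
  The bad event for a vertex set: the greedy colouring, which repeatedly removes an independent set of
  size \<open>s\<close>, can get stuck while at least \<open>N\<close> vertices remain. It is enough to look at
  subsets of size exactly \<open>N\<close>, as larger ones contain them.
\<close>

definition deficient :: "nat \<Rightarrow> nat \<Rightarrow> ('a set \<Rightarrow> bool) \<Rightarrow> 'a set \<Rightarrow> bool" where
  "deficient s N X V \<longleftrightarrow>
     (\<exists>U \<subseteq> V. card U = N \<and> (\<forall>I \<subseteq> U. card I = s \<longrightarrow> (\<exists>e\<in>vertex_pairs I. X e)))"

text \<open>
  A union bound over the subsets of size \<open>s * q\<close>. Each single event only depends on the pairs
  inside its subset, so it has the same probability in the smaller random graph.
\<close>

lemma prob_deficient:
  fixes V W :: "'a set"
  assumes W: "finite W" "V \<subseteq> W" and s: "2 \<le> s" and q: "0 < q"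
    and p: "0 < p" "p < 1" and c: "c = 1 / sqrt (1 - p)"
    and small: "real s / real q * c ^ (s + 1) \<le> 1 / 2"
  shows "measure_pmf.prob (coin_flips (vertex_pairs W) p) {X. deficient s (s * q) X V}
         \<le> 2 ^ card V * exp (- (real q)\<^sup>2 / (c ^ 4 * real s ^ 6))"
proof -
  let ?P = "measure_pmf.prob (coin_flips (vertex_pairs W) p)"
  let ?hit = "\<lambda>U. {X. \<forall>I \<subseteq> U. card I = s \<longrightarrow> (\<exists>e\<in>vertex_pairs I. X e)}"
  let ?U = "{U. U \<subseteq> V \<and> card U = s * q}"
  have finV: "finite V" using W finite_subset by blast
  have finU: "finite ?U" using finV by simp
  have hit: "?P (?hit U) \<le> exp (- (real q)\<^sup>2 / (c ^ 4 * real s ^ 6))" if "U \<in> ?U" for U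
  proof -
    have UV: "U \<subseteq> V" "card U = s * q" using that by auto
    let ?R = "\<lambda>X e. if e \<in> vertex_pairs U then X e else False"
    have "coin_flips (vertex_pairs U) p = map_pmf ?R (coin_flips (vertex_pairs W) p)"
      using UV W by (intro Pi_pmf_subset finite_vertex_pairs vertex_pairs_mono) auto
    then have "measure_pmf.prob (coin_flips (vertex_pairs U) p) (?hit U) = ?P (?R -` ?hit U)"
      by simp
    also have "?R -` ?hit U = ?hit U"
    proof -
      have "vertex_pairs I \<subseteq> vertex_pairs U" if "I \<subseteq> U" for I using that by (rule vertex_pairs_mono)
      then have "(\<exists>e\<in>vertex_pairs I. ?R X e) \<longleftrightarrow> (\<exists>e\<in>vertex_pairs I. X e)" if "I \<subseteq> U" for I X
        using that by (metis subsetD)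
      then show ?thesis by auto
    qed
    finally have "?P (?hit U) = measure_pmf.prob (coin_flips (vertex_pairs U) p) (?hit U)" by simp
    also have "\<dots> \<le> exp (- (real q)\<^sup>2 / (c ^ 4 * real s ^ 6))"
      using finite_subset[OF UV(1) finV] UV(2) s q p c small by (intro prob_no_independent_set) auto
    finally show ?thesis .
  qed
  have "{X. deficient s (s * q) X V} = (\<Union>U\<in>?U. ?hit U)" by (auto simp: deficient_def)
  then have "?P {X. deficient s (s * q) X V} \<le> (\<Sum>U\<in>?U. ?P (?hit U))"
    using finU by (simp only:) (intro measure_pmf.finite_measure_subadditive_finite, auto)
  also have "\<dots> \<le> real (card ?U) * exp (- (real q)\<^sup>2 / (c ^ 4 * real s ^ 6))"
    using hit by (intro sum_bounded_above) auto
  also have "\<dots> \<le> 2 ^ card V * exp (- (real q)\<^sup>2 / (c ^ 4 * real s ^ 6))"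
  proof (intro mult_right_mono)
    have "card ?U \<le> card (Pow V)" using finV by (intro card_mono) auto
    then show "real (card ?U) \<le> 2 ^ card V"
      using finV by (simp add: card_Pow)
  qed simp
  finally show ?thesis .
qed

section \<open>Combining colourings\<close>

definition colourable :: "'a set \<Rightarrow> 'a set set \<Rightarrow> nat \<Rightarrow> bool" where
  "colourable V E k \<longleftrightarrow> (\<exists>c. proper_colouring V E k c)"

lemma chromatic_number_le: "colourable V E k \<Longrightarrow> chromatic_number V E \<le> k"
  unfolding colourable_def chromatic_number_def by (rule Least_le)

lemma colourable_by_set:
  assumes "finite C" "f ` V \<subseteq> C" "\<And>u v. u \<in> V \<Longrightarrow> v \<in> V \<Longrightarrow> {u, v} \<in> E \<Longrightarrow> f u \<noteq> f v"
  shows "colourable V E (card C)"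
proof -
  obtain h where h: "bij_betw h C {0..<card C}" using ex_bij_betw_finite_nat[OF assms(1)] by blast
  have "proper_colouring V E (card C) (h \<circ> f)"
    unfolding proper_colouring_def
  proof (intro conjI ballI impI)
    fix v assume "v \<in> V"
    then show "(h \<circ> f) v < card C" using assms(2) bij_betwE[OF h] by auto
  next
    fix u v assume "u \<in> V" "v \<in> V" "{u, v} \<in> E"
    then show "(h \<circ> f) u \<noteq> (h \<circ> f) v"
      using assms(2) assms(3)[of u v] inj_onD[OF bij_betw_imp_inj_on[OF h], of "f u" "f v"] by auto
  qed
  then show ?thesis by (auto simp: colourable_def)
qed

lemma colourable_card:
  assumes "finite V" "\<And>v. {v} \<notin> E"
  shows "colourable V E (card V)"
  by (rule colourable_by_set[of _ "\<lambda>v. v"]) (use assms in auto)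

lemma colourable_mono: "colourable V E j \<Longrightarrow> j \<le> k \<Longrightarrow> colourable V E k"
  unfolding colourable_def proper_colouring_def by (meson less_le_trans)

lemma colourable_chromatic_number:
  assumes "finite V" "\<And>v. {v} \<notin> E"
  shows "colourable V E (chromatic_number V E)"
  using colourable_card[OF assms] unfolding colourable_def chromatic_number_def
  by (rule LeastI[of "\<lambda>k. \<exists>c. proper_colouring V E k c"])

text \<open>
  One colour for each removed independent set, then a colour of its own for each of the fewer than \<open>N\<close>
  vertices that remain.
\<close>

lemma colourable_greedy:
  assumes "finite V" and E: "\<And>v. {v} \<notin> E" and s: "1 \<le> s"
    and "\<And>U. U \<subseteq> V \<Longrightarrow> card U = N \<Longrightarrow> \<exists>I \<subseteq> U. card I = s \<and> vertex_pairs I \<inter> E = {}"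
  shows "colourable V E (card V div s + N)"
  using assms(1,4)
proof (induction "card V" arbitrary: V rule: less_induct)
  case less
  show ?case
  proof (cases "card V < N")
    case True
    then show ?thesis using colourable_mono[OF colourable_card[OF less.prems(1) E]] by simp
  next
    case False
    then obtain U where "U \<subseteq> V" "card U = N" using obtain_subset_with_card_n[of N V] by auto
    then obtain I where "I \<subseteq> U" and I: "card I = s" "vertex_pairs I \<inter> E = {}"
      using less.prems(2)[of U] by auto
    with \<open>U \<subseteq> V\<close> have IV: "I \<subseteq> V" by simp
    have sV: "s \<le> card V" using I IV less.prems(1) card_mono by blast
    have card_rest: "card (V - I) = card V - s"
      using I IV less.prems(1) by (simp add: card_Diff_subset finite_subset)
    define k where "k = card (V - I) div s + N"
    have "colourable (V - I) E k" unfolding k_def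
      using less.prems sV s card_rest by (intro less.hyps) auto
    then obtain c where c: "proper_colouring (V - I) E k c" by (auto simp: colourable_def)
    have "colourable V E (card {..k})"
    proof (rule colourable_by_set)
      show "(\<lambda>v. if v \<in> I then k else c v) ` V \<subseteq> {..k}"
        using c by (auto simp: proper_colouring_def less_imp_le)
      fix u v assume uv: "u \<in> V" "v \<in> V" "{u, v} \<in> E"
      have "u \<notin> I \<or> v \<notin> I"
      proof (rule ccontr)
        assume "\<not> (u \<notin> I \<or> v \<notin> I)"
        moreover have "u \<noteq> v" using uv E by auto
        ultimately have "{u, v} \<in> vertex_pairs I" by (auto simp: vertex_pairs_def)
        then show False using I uv by auto
      qed
      then show "(if u \<in> I then k else c u) \<noteq> (if v \<in> I then k else c v)"
        using c uv by (auto simp: proper_colouring_def)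
    qed simp
    moreover have "card {..k} = card V div s + N"
      using sV s by (simp add: k_def card_rest le_div_geq)
    ultimately show ?thesis by simp
  qed
qed

text \<open>
  Recolour every colour class of \<open>H\<close> with a palette of its own: edges of \<open>H\<close> join different
  classes, so inside a class only the edges of \<open>G\<close> have to be respected.
\<close>

lemma colourable_union:
  assumes c: "proper_colouring V H k c"
    and parts: "\<And>i. i < k \<Longrightarrow> colourable {v\<in>V. c v = i} G (m i)"
  shows "colourable V (H \<union> G) (\<Sum>i<k. m i)"
proof -
  obtain d where d: "\<And>i. i < k \<Longrightarrow> proper_colouring {v\<in>V. c v = i} G (m i) (d i)"
    using parts unfolding colourable_def by metis
  have "colourable V (H \<union> G) (card (SIGMA i:{..<k}. {..<m i}))"
  proof (rule colourable_by_set)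
    show "(\<lambda>v. (c v, d (c v) v)) ` V \<subseteq> (SIGMA i:{..<k}. {..<m i})"
    proof safe
      fix v assume v: "v \<in> V"
      then have "c v < k" using c by (simp add: proper_colouring_def)
      with v d[of "c v"] show "c v < k" "d (c v) v < m (c v)" by (simp_all add: proper_colouring_def)
    qed
    fix u v assume uv: "u \<in> V" "v \<in> V" "{u, v} \<in> H \<union> G"
    show "(c u, d (c u) u) \<noteq> (c v, d (c v) v)"
    proof (cases "{u, v} \<in> H")
      case True
      then show ?thesis using c uv by (auto simp: proper_colouring_def)
    next
      case False
      then show ?thesis using c d[of "c u"] uv by (auto simp: proper_colouring_def)
    qed
  qed simp
  then show ?thesis by (simp add: card_SigmaI)
qed

section \<open>The chromatic number of a randomly augmented graph\<close>

text \<open>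
  The classes of a colouring of \<open>H\<close> are coloured separately. A class with fewer than \<open>t\<close> vertices
  gets pairwise distinct colours, at a total cost of at most \<open>k * t\<close>. A larger class is
  coloured greedily, at cost \<open>K\<close> per vertex, unless it is deficient; then it also gets distinct
  colours. Individual classes may well be deficient when there are many of them, but a class of size
  \<open>m\<close> is so with probability at most \<open>1 / m\<close>, so the expected number of vertices in deficient classes
  is at most the number \<open>k\<close> of classes, and Markov's inequality bounds it by \<open>a\<close>.
\<close>

lemma chromatic_number_augmented_tail:
  fixes W :: "'a set" and H :: "'a set set" and K a t :: real
  assumes W: "finite W" and c: "proper_colouring W H k c"
    and K: "0 \<le> K" and a: "0 < a" and t: "0 \<le> t"
    and s: "\<And>m. t \<le> real m \<Longrightarrow> 1 \<le> s m"
    and cost: "\<And>m. t \<le> real m \<Longrightarrow> real (m div s m) + real (N m) \<le> K * real m"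
    and rare: "\<And>V. V \<subseteq> W \<Longrightarrow> t \<le> real (card V) \<Longrightarrow>
      measure_pmf.prob (coin_flips (vertex_pairs W) p) {X. deficient (s (card V)) (N (card V)) X V}
        \<le> 1 / real (card V)"
  shows "measure_pmf.prob (coin_flips (vertex_pairs W) p)
      {X. real (chromatic_number W (H \<union> {e \<in> vertex_pairs W. X e})) \<le> k * t + a + K * card W}
    \<ge> 1 - k / a"
proof -
  let ?M = "coin_flips (vertex_pairs W) p"
  define C where "C i = {v\<in>W. c v = i}" for i
  define L where "L = {i. i < k \<and> t \<le> real (card (C i))}"
  define bad where "bad i = {X. deficient (s (card (C i))) (N (card (C i))) X (C i)}" for i
  \<comment> \<open>The number of vertices in deficient large classes.\<close>
  define B where "B X = (\<Sum>i\<in>L. real (card (C i)) * indicator (bad i) X)" for X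
  define m where "m X i = (if i \<notin> L \<or> X \<in> bad i then card (C i)
      else card (C i) div s (card (C i)) + N (card (C i)))" for X i
  have finC: "finite (C i)" and CW: "C i \<subseteq> W" for i using W by (auto simp: C_def)
  have card_W: "(\<Sum>i<k. card (C i)) = card W"
  proof -
    have "W = (\<Union>i<k. C i)" using c by (auto simp: C_def proper_colouring_def)
    moreover have "card (\<Union>i<k. C i) = (\<Sum>i<k. card (C i))"
      using finC by (intro card_UN_disjoint) (auto simp: C_def)
    ultimately show ?thesis by simp
  qed
  have cols: "chromatic_number W (H \<union> {e \<in> vertex_pairs W. X e}) \<le> (\<Sum>i<k. m X i)" for X
  proof (intro chromatic_number_le colourable_union[OF c], fold C_def)
    fix i assume i: "i < k"
    let ?G = "{e \<in> vertex_pairs W. X e}"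
    have G: "{v} \<notin> ?G" for v by (simp add: vertex_pairs_def)
    show "colourable (C i) ?G (m X i)"
    proof (cases "i \<notin> L \<or> X \<in> bad i")
      case True
      then show ?thesis using colourable_card[OF finC G] by (simp add: m_def)
    next
      case False
      then have "i \<in> L" and good: "\<not> deficient (s (card (C i))) (N (card (C i))) X (C i)"
        by (auto simp: bad_def)
      have "colourable (C i) ?G (card (C i) div s (card (C i)) + N (card (C i)))"
      proof (rule colourable_greedy[OF finC G])
        show "1 \<le> s (card (C i))" using \<open>i \<in> L\<close> s by (simp add: L_def)
        fix U assume "U \<subseteq> C i" "card U = N (card (C i))"
        with good have "\<not> (\<forall>I\<subseteq>U. card I = s (card (C i)) \<longrightarrow> (\<exists>e\<in>vertex_pairs I. X e))"
          by (auto simp: deficient_def)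
        then obtain I where "I \<subseteq> U" "card I = s (card (C i))" "\<forall>e\<in>vertex_pairs I. \<not> X e"
          by auto
        then show "\<exists>I\<subseteq>U. card I = s (card (C i)) \<and> vertex_pairs I \<inter> ?G = {}"
          by (intro exI[of _ I]) auto
      qed
      then show ?thesis using False by (simp add: m_def)
    qed
  qed
  have m_le: "real (m X i) \<le> t + (if i \<in> L then real (card (C i)) * indicator (bad i) X else 0)
      + K * real (card (C i))" if "i < k" for X i
  proof (cases "i \<in> L")
    case True
    then show ?thesis using cost[of "card (C i)"] K t by (auto simp: m_def L_def add_increasing)
  next
    case False
    then have "real (card (C i)) \<le> t" using that by (auto simp: L_def)
    then show ?thesis using False K by (simp add: m_def add_increasing2)
  qed
  have total: "real (\<Sum>i<k. m X i) \<le> k * t + B X + K * card W" for X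
  proof -
    have "real (\<Sum>i<k. m X i) \<le> (\<Sum>i<k. t +
        (if i \<in> L then real (card (C i)) * indicator (bad i) X else 0) + K * real (card (C i)))"
      unfolding of_nat_sum by (intro sum_mono m_le) simp
    also have "\<dots> = k * t + (\<Sum>i<k. if i \<in> L then real (card (C i)) * indicator (bad i) X else 0)
        + K * real (\<Sum>i<k. card (C i))"
      by (simp add: sum.distrib sum_distrib_left)
    also have "(\<Sum>i<k. if i \<in> L then real (card (C i)) * indicator (bad i) X else 0) = B X"
      unfolding B_def by (rule sum.mono_neutral_cong_right) (auto simp: L_def)
    finally show ?thesis by (simp add: card_W)
  qed
  have intB: "integrable (measure_pmf ?M) B" using W by simp
  have EB: "measure_pmf.expectation ?M B \<le> k"
  proof -
    have "measure_pmf.expectation ?M B = (\<Sum>i\<in>L. real (card (C i)) * measure_pmf.prob ?M (bad i))"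
      unfolding B_def using W by (subst Bochner_Integration.integral_sum) simp_all
    also have "\<dots> \<le> (\<Sum>i\<in>L. 1)"
    proof (intro sum_mono)
      fix i assume "i \<in> L"
      then have "real (card (C i)) * measure_pmf.prob ?M (bad i) \<le> real (card (C i)) * (1 / real (card (C i)))"
        using rare[OF CW] unfolding bad_def by (intro mult_left_mono) (auto simp: L_def)
      then show "real (card (C i)) * measure_pmf.prob ?M (bad i) \<le> 1"
        by (cases "card (C i) = 0") auto
    qed
    also have "\<dots> \<le> k"
    proof -
      have "card L \<le> card {..<k}" by (intro card_mono) (auto simp: L_def)
      then show ?thesis by simp
    qed
    finally show ?thesis .
  qed
  have "0 \<le> B X" for X by (simp add: B_def sum_nonneg)
  then have "measure_pmf.prob ?M {X. B X \<ge> a} \<le> measure_pmf.expectation ?M B / a"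
    using integral_Markov_inequality_measure[OF intB, of "{}" a] a by simp
  also have "\<dots> \<le> k / a" using EB a by (intro divide_right_mono) auto
  finally have "1 - k / a \<le> 1 - measure_pmf.prob ?M {X. B X \<ge> a}" by simp
  also have "\<dots> = measure_pmf.prob ?M (- {X. B X \<ge> a})"
    by (subst measure_pmf.prob_compl[symmetric]) (auto simp: Compl_eq_Diff_UNIV)
  also have "\<dots> \<le> measure_pmf.prob ?M
      {X. real (chromatic_number W (H \<union> {e \<in> vertex_pairs W. X e})) \<le> k * t + a + K * card W}"
  proof (intro measure_pmf.finite_measure_mono subsetI CollectI)
    fix X assume "X \<in> - {X. B X \<ge> a}"
    then have "B X \<le> a" by auto
    have "real (chromatic_number W (H \<union> {e \<in> vertex_pairs W. X e})) \<le> real (\<Sum>i<k. m X i)"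
      using cols[of X] of_nat_le_iff by blast
    also have "\<dots> \<le> k * t + B X + K * card W" by (rule total)
    finally show "real (chromatic_number W (H \<union> {e \<in> vertex_pairs W. X e})) \<le> k * t + a + K * card W"
      using \<open>B X \<le> a\<close> by linarith
  qed simp
  finally show ?thesis .
qed

text \<open>
  The choice of parameters for a class of size \<open>m\<close>. The set size \<open>s\<close> is slightly less than
  \<open>2 ln m / B\<close>, twice the logarithm to base \<open>1 / (1 - p)\<close>, and \<open>q\<close> is about \<open>m / ln\<^sup>4 m\<close>. The gap in
  \<open>s\<close> gains a power of \<open>m\<close> in the smallness condition, more than the logarithmic factors lost in
  \<open>q\<close>. The failure exponent is \<open>m\<^sup>2\<close> up to logarithmic factors and beats the union
  bound \<open>2 ^ m\<close>, while the \<open>s * q\<close> leftover vertices, about \<open>m / ln\<^sup>3 m\<close>, are negligible against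
  the main term \<open>m / s\<close>.
\<close>

lemma colouring_parameters:
  fixes p e :: real
  assumes p: "0 < p" "p < 1" and e: "0 < e"
  defines "B \<equiv> ln (1 / (1 - p))" and "c \<equiv> 1 / sqrt (1 - p)"
  shows "\<exists>s q :: nat \<Rightarrow> nat. \<forall>\<^sub>F m in sequentially. 2 \<le> s m \<and> 0 < q m \<and>
     real (s m) / real (q m) * c ^ (s m + 1) \<le> 1 / 2 \<and>
     2 ^ m * exp (- (real (q m))\<^sup>2 / (c ^ 4 * real (s m) ^ 6)) \<le> 1 / real m \<and>
     real (m div s m) + real (s m * q m) \<le> (1 + e) * B / (2 * ln (real m)) * real m"
proof -
  \<comment> \<open>With this gap, \<open>1 / (2 - \<delta>)\<close> stays strictly below \<open>(1 + e) / 2\<close>.\<close>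
  define \<delta> where "\<delta> = e / (1 + e)"
  define a where "a = (2 - \<delta>) / B"
  have B: "0 < B" using p by (simp add: B_def)
  have \<delta>: "0 < \<delta>" "\<delta> < 1" using e by (simp_all add: \<delta>_def)
  have a: "0 < a" using B \<delta> by (simp add: a_def)
  have c0: "0 < c" using p by (simp add: c_def)
  have c: "c = exp (B / 2)"
  proof -
    have "exp (B / 2) ^ 2 = c ^ 2"
      using p by (simp add: exp_of_nat_mult[symmetric] B_def c_def power_divide)
    then show ?thesis using c0 by (simp add: power2_eq_iff_nonneg)
  qed
  have inv_a: "1 / a < (1 + e) * B / 2"
  proof -
    have "2 < (1 + e) * (2 - \<delta>)" using e by (simp add: \<delta>_def field_simps add_pos_pos)
    then have "1 / (2 - \<delta>) < (1 + e) / 2" using \<delta> by (simp add: field_simps)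
    then have "B * (1 / (2 - \<delta>)) < B * ((1 + e) / 2)" using B by (intro mult_strict_left_mono)
    then show ?thesis by (simp add: a_def mult_ac)
  qed
  define s q :: "nat \<Rightarrow> nat" where "s m = nat \<lfloor>a * ln (real m)\<rfloor>"
    and "q m = nat \<lfloor>real m / ln (real m) ^ 4\<rfloor>" for m
  have "((\<lambda>m::nat. (real m / (a * ln (real m) - 1) + a * ln (real m) * (real m / ln (real m) ^ 4))
      / (real m / ln (real m))) \<longlongrightarrow> 1 / a) sequentially"
    using a by (real_asymp simp: field_simps)
  then have "\<forall>\<^sub>F m::nat in sequentially. (real m / (a * ln (real m) - 1)
      + a * ln (real m) * (real m / ln (real m) ^ 4)) / (real m / ln (real m)) < (1 + e) * B / 2"
    using inv_a by (rule order_tendstoD)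
  moreover have "\<forall>\<^sub>F m::nat in sequentially. 3 \<le> a * ln (real m)"
    using a by real_asymp
  moreover have "\<forall>\<^sub>F m::nat in sequentially. 1 \<le> real m / ln (real m) ^ 4 - 1"
    by real_asymp
  moreover have "\<forall>\<^sub>F m::nat in sequentially. a * ln (real m) / (real m / ln (real m) ^ 4 - 1)
      * (c * exp ((1 - \<delta> / 2) * ln (real m))) \<le> 1 / 2"
    using a c0 \<delta> by real_asymp
  moreover have "\<forall>\<^sub>F m::nat in sequentially. real m * ln 2 + ln (real m)
      \<le> (real m / ln (real m) ^ 4 - 1)\<^sup>2 / (c ^ 4 * (a * ln (real m)) ^ 6)"
    using a c0 by real_asymp
  ultimately have "\<forall>\<^sub>F m in sequentially. 2 \<le> s m \<and> 0 < q m \<and>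
     real (s m) / real (q m) * c ^ (s m + 1) \<le> 1 / 2 \<and>
     2 ^ m * exp (- (real (q m))\<^sup>2 / (c ^ 4 * real (s m) ^ 6)) \<le> 1 / real m \<and>
     real (m div s m) + real (s m * q m) \<le> (1 + e) * B / (2 * ln (real m)) * real m"
  proof eventually_elim
    case (elim m)
    define L where "L = ln (real m)"
    define Q where "Q = real m / L ^ 4"
    note elim = elim[folded L_def, folded Q_def]
    have L: "0 < L" using elim(2) a by (smt (verit) mult_nonneg_nonpos)
    then have m: "1 < real m" by (cases "m = 0") (auto simp: L_def)
    have s: "a * L - 1 \<le> real (s m)" "real (s m) \<le> a * L"
      using elim(2) by (simp_all add: s_def L_def[symmetric])
    have q: "Q - 1 \<le> real (q m)" "real (q m) \<le> Q"
      using elim(3) by (simp_all add: q_def L_def[symmetric] Q_def[symmetric])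
    have s2: "2 \<le> s m" using s elim(2) by linarith
    have q1: "0 < q m" using q elim(3) by linarith
    have "c ^ (s m + 1) = c * exp (real (s m) * (B / 2))"
      by (simp only: exp_of_nat_mult) (simp add: c)
    also have "\<dots> \<le> c * exp (a * L * (B / 2))"
      using s B c0 by (intro mult_left_mono) auto
    also have "a * L * (B / 2) = (1 - \<delta> / 2) * L"
      using B by (simp add: a_def field_simps)
    finally have c_pow: "c ^ (s m + 1) \<le> c * exp ((1 - \<delta> / 2) * L)" .
    have "real (s m) / real (q m) * c ^ (s m + 1) \<le> a * L / (Q - 1) * (c * exp ((1 - \<delta> / 2) * L))"
      using s q elim(2,3) c0 by (intro mult_mono frac_le c_pow) auto
    then have small: "real (s m) / real (q m) * c ^ (s m + 1) \<le> 1 / 2" using elim(4) by linarith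
    have "real m * ln 2 + ln (real m) \<le> (Q - 1)\<^sup>2 / (c ^ 4 * (a * L) ^ 6)"
      using elim(5) by (simp add: L_def)
    also have "\<dots> \<le> (real (q m))\<^sup>2 / (c ^ 4 * real (s m) ^ 6)"
      using s q s2 elim(2,3) c0 by (intro frac_le power_mono mult_left_mono) auto
    finally have "exp (- (real (q m))\<^sup>2 / (c ^ 4 * real (s m) ^ 6))
        \<le> exp (- (real m * ln 2 + ln (real m)))" by simp
    also have "\<dots> = 1 / (2 ^ m * real m)"
      using m by (simp add: exp_diff exp_minus exp_of_nat_mult field_simps)
    finally have "2 ^ m * exp (- (real (q m))\<^sup>2 / (c ^ 4 * real (s m) ^ 6))
        \<le> 2 ^ m * (1 / (2 ^ m * real m))"
      by (intro mult_left_mono) auto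
    then have rare: "2 ^ m * exp (- (real (q m))\<^sup>2 / (c ^ 4 * real (s m) ^ 6)) \<le> 1 / real m"
      by simp
    have "real (m div s m) + real (s m * q m) \<le> real m / (a * L - 1) + a * L * Q"
    proof (intro add_mono)
      have "real (m div s m) \<le> real m / real (s m)" by (rule of_nat_div_le_of_nat)
      also have "\<dots> \<le> real m / (a * L - 1)" using s elim(2) by (intro divide_left_mono) auto
      finally show "real (m div s m) \<le> real m / (a * L - 1)" .
      show "real (s m * q m) \<le> a * L * Q"
        using s q elim(2) unfolding of_nat_mult by (intro mult_mono) auto
    qed
    also have "\<dots> \<le> (1 + e) * B / 2 * (real m / L)"
    proof -
      have "0 < real m / L" using m L by simp
      from elim(1)[unfolded pos_divide_less_eq[OF this]] show ?thesis by (rule less_imp_le)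
    qed
    finally have "real (m div s m) + real (s m * q m) \<le> (1 + e) * B / (2 * ln (real m)) * real m"
      by (simp add: L_def)
    then show ?case using s2 q1 small rare by blast
  qed
  then show ?thesis by blast
qed

theorem theorem2p9:
  fixes p b \<epsilon> :: real
    and \<beta> :: "nat \<Rightarrow> nat"
    and H :: "nat \<Rightarrow> nat set set"
  assumes "0 < p" and "p < 1"
    and "b = 1 / (1 - p)"
    and "filterlim \<beta> at_top sequentially"
    and "\<And>n. n \<ge> 1 \<Longrightarrow> simple_graph {1..n} (H n)"
    and "\<And>n. n \<ge> 1 \<Longrightarrow> real (chromatic_number {1..n} (H n)) = real n / real (\<beta> n)"
    and "\<epsilon> > 0"
  shows "(\<lambda>n. measure_pmf.prob (pert n (H n) p)
            {G. real (chromatic_number {1..n} G)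
                  \<le> (1 + \<epsilon>) * (real n * ln b /
                      (2 * (ln (real n) - ln (real (chromatic_number {1..n} (H n))))))})
         \<longlonglongrightarrow> 1"
proof -
  define B where "B = ln b"
  define e where "e = \<epsilon> / 4"
  \<comment> \<open>Classes with fewer than \<open>\<beta> n powr (1 - \<delta>)\<close> vertices count as small.
    This \<open>\<delta>\<close> makes the two losses combine to the factor \<open>1 + \<epsilon> / 2\<close>.\<close>
  define \<delta> where "\<delta> = e / (1 + \<epsilon> / 2)"
  have e: "0 < e" using \<open>\<epsilon> > 0\<close> by (simp add: e_def)
  have \<delta>: "0 < \<delta>" "\<delta> < 1" and ratio: "(1 + e) / (1 - \<delta>) = 1 + \<epsilon> / 2"
    using \<open>\<epsilon> > 0\<close> by (simp_all add: \<delta>_def e_def field_simps)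
  have B: "0 < B" using assms(1-3) by (simp add: B_def)
  define c where "c = 1 / sqrt (1 - p)"
  from colouring_parameters[OF assms(1,2) e]
  obtain s q :: "nat \<Rightarrow> nat" where "\<forall>\<^sub>F m in sequentially. 2 \<le> s m \<and> 0 < q m \<and>
     real (s m) / real (q m) * c ^ (s m + 1) \<le> 1 / 2 \<and>
     2 ^ m * exp (- (real (q m))\<^sup>2 / (c ^ 4 * real (s m) ^ 6)) \<le> 1 / real m \<and>
     real (m div s m) + real (s m * q m) \<le> (1 + e) * B / (2 * ln (real m)) * real m"
    unfolding c_def B_def assms(3) by blast
  then obtain M where M: "\<And>m. M \<le> m \<Longrightarrow> 2 \<le> s m \<and> 0 < q m \<and>
     real (s m) / real (q m) * c ^ (s m + 1) \<le> 1 / 2 \<and>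
     2 ^ m * exp (- (real (q m))\<^sup>2 / (c ^ 4 * real (s m) ^ 6)) \<le> 1 / real m \<and>
     real (m div s m) + real (s m * q m) \<le> (1 + e) * B / (2 * ln (real m)) * real m"
    unfolding eventually_sequentially by blast
  have error: "\<forall>\<^sub>F x::nat in sequentially.
      real x powr (- \<delta>) + real x powr (- 1 / 2) \<le> \<epsilon> / 2 * (B / (2 * ln (real x)))"
  proof -
    have "((\<lambda>x::nat. real x powr (- \<delta>) * ln (real x)) \<longlongrightarrow> 0) sequentially"
      using \<delta> by real_asymp
    moreover have "((\<lambda>x::nat. real x powr (- 1 / 2) * ln (real x)) \<longlongrightarrow> 0) sequentially"
      by real_asymp
    ultimately have "((\<lambda>x::nat. (real x powr (- \<delta>) + real x powr (- 1 / 2)) * ln (real x)) \<longlongrightarrow> 0) sequentially"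
      unfolding distrib_right by (rule tendsto_add_zero)
    then have "\<forall>\<^sub>F x::nat in sequentially.
        (real x powr (- \<delta>) + real x powr (- 1 / 2)) * ln (real x) < \<epsilon> * B / 4"
      using B \<open>\<epsilon> > 0\<close> by (intro order_tendstoD) auto
    moreover have "\<forall>\<^sub>F x::nat in sequentially. 0 < ln (real x)" by real_asymp
    ultimately show ?thesis by eventually_elim (simp add: field_simps)
  qed
  have "\<forall>\<^sub>F x::nat in sequentially. real M < real x powr (1 - \<delta>)"
    using \<delta> by real_asymp
  moreover have "\<forall>\<^sub>F x::nat in sequentially. 0 < ln (real x)" by real_asymp
  ultimately have "\<forall>\<^sub>F x in sequentially. real M < real x powr (1 - \<delta>) \<and> 0 < ln (real x) \<and>
      real x powr (- \<delta>) + real x powr (- 1 / 2) \<le> \<epsilon> / 2 * (B / (2 * ln (real x)))"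
    using error by eventually_elim blast
  then have "\<forall>\<^sub>F n in sequentially. real M < real (\<beta> n) powr (1 - \<delta>) \<and> 0 < ln (real (\<beta> n)) \<and>
      real (\<beta> n) powr (- \<delta>) + real (\<beta> n) powr (- 1 / 2) \<le> \<epsilon> / 2 * (B / (2 * ln (real (\<beta> n))))"
    using assms(4) by (rule eventually_compose_filterlim)
  then have lower: "\<forall>\<^sub>F n in sequentially. 1 - real (\<beta> n) powr (- 1 / 2)
      \<le> measure_pmf.prob (pert n (H n) p) {G. real (chromatic_number {1..n} G)
                  \<le> (1 + \<epsilon>) * (real n * ln b /
                      (2 * (ln (real n) - ln (real (chromatic_number {1..n} (H n))))))}"
    using eventually_ge_at_top[of 1]
  proof eventually_elim
    case (elim n)
    define k where "k = chromatic_number {1..n} (H n)"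
    define x where "x = real (\<beta> n)"
    have x: "real M < x powr (1 - \<delta>)" "0 < ln x"
        "x powr (- \<delta>) + x powr (- 1 / 2) \<le> \<epsilon> / 2 * (B / (2 * ln x))"
      using elim by (simp_all add: x_def)
    have x0: "0 < x" using x(2) by (cases "x = 0") (auto simp: x_def)
    have n: "0 < real n" using elim by simp
    have k: "real k = real n / x" using assms(6)[of n] elim by (simp add: k_def x_def)
    have ln_x: "ln (real n) - ln (real k) = ln x" using n x0 by (simp add: k ln_div)
    have H: "{v} \<notin> H n" for v
      using assms(5)[of n] elim by (auto simp: simple_graph_def vertex_pairs_def)
    obtain col where col: "proper_colouring {1..n} (H n) k col"
      using colourable_chromatic_number[of "{1..n}" "H n"] H by (auto simp: colourable_def k_def)
    define K where "K = (1 + \<epsilon> / 2) * (B / (2 * ln x))"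
    have large: "M \<le> m \<and> (1 - \<delta>) * ln x \<le> ln (real m)" if "x powr (1 - \<delta>) \<le> real m" for m
    proof
      show "M \<le> m" using that x(1) by linarith
      have "ln (x powr (1 - \<delta>)) \<le> ln (real m)" using that x0 by (intro ln_mono) auto
      then show "(1 - \<delta>) * ln x \<le> ln (real m)" using x0 by (simp add: ln_powr)
    qed
    have "1 - real k / (real n * x powr (- 1 / 2)) \<le>
      measure_pmf.prob (coin_flips (vertex_pairs {1..n}) p)
      {X. real (chromatic_number {1..n} (H n \<union> {e \<in> vertex_pairs {1..n}. X e}))
        \<le> real k * x powr (1 - \<delta>) + real n * x powr (- 1 / 2) + K * real (card {1..n})}"
    proof (rule chromatic_number_augmented_tail[where s = s and N = "\<lambda>m. s m * q m"])
      show "0 \<le> K" using B x(2) \<open>\<epsilon> > 0\<close> by (simp add: K_def)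
      show "0 < real n * x powr (- 1 / 2)" using n x0 by simp
      fix m assume "x powr (1 - \<delta>) \<le> real m"
      note m = large[OF this]
      show "1 \<le> s m" using M[of m] m by simp
      have "real (m div s m) + real (s m * q m) \<le> (1 + e) * B / (2 * ln (real m)) * real m"
        using M[of m] m by blast
      also have "\<dots> \<le> (1 + e) * B / (2 * ((1 - \<delta>) * ln x)) * real m"
        using m e B \<delta> x(2) by (intro mult_right_mono frac_le) auto
      also have "\<dots> = ((1 + e) / (1 - \<delta>)) * (B / (2 * ln x)) * real m" by simp
      also have "\<dots> = K * real m" by (simp only: ratio K_def)
      finally show "real (m div s m) + real (s m * q m) \<le> K * real m" .
    next
      fix V assume V: "V \<subseteq> {1..n}" "x powr (1 - \<delta>) \<le> real (card V)"
      let ?m = "card V"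
      have "measure_pmf.prob (coin_flips (vertex_pairs {1..n}) p) {X. deficient (s ?m) (s ?m * q ?m) X V}
          \<le> 2 ^ ?m * exp (- (real (q ?m))\<^sup>2 / (c ^ 4 * real (s ?m) ^ 6))"
        using M[of ?m] large[OF V(2)] V(1) assms(1,2) by (intro prob_deficient) (auto simp: c_def)
      also have "\<dots> \<le> 1 / real ?m" using M[of ?m] large[OF V(2)] by blast
      finally show "measure_pmf.prob (coin_flips (vertex_pairs {1..n}) p)
          {X. deficient (s ?m) (s ?m * q ?m) X V} \<le> 1 / real ?m" .
    qed (use col in auto)
    also have "real k * x powr (1 - \<delta>) + real n * x powr (- 1 / 2) + K * real (card {1..n})
        = real n * (x powr (- \<delta>) + x powr (- 1 / 2) + K)"
      using x0 by (simp add: k powr_diff powr_minus field_simps)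
    also have "real k / (real n * x powr (- 1 / 2)) = x powr (- 1 / 2)"
    proof -
      have "x powr (- 1 / 2) * x powr (- 1 / 2) = 1 / x"
        using x0 by (simp add: powr_add[symmetric] powr_minus_divide)
      then show ?thesis using x0 n by (simp add: k field_simps)
    qed
    finally have "1 - x powr (- 1 / 2) \<le> measure_pmf.prob (coin_flips (vertex_pairs {1..n}) p)
      {X. real (chromatic_number {1..n} (H n \<union> {e \<in> vertex_pairs {1..n}. X e}))
        \<le> real n * (x powr (- \<delta>) + x powr (- 1 / 2) + K)}" .
    also have "\<dots> \<le> measure_pmf.prob (coin_flips (vertex_pairs {1..n}) p)
      {X. real (chromatic_number {1..n} (H n \<union> {e \<in> vertex_pairs {1..n}. X e}))
        \<le> (1 + \<epsilon>) * (real n * B / (2 * ln x))}"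
    proof (intro measure_pmf.finite_measure_mono subsetI CollectI)
      have "x powr (- \<delta>) + x powr (- 1 / 2) + K \<le> (1 + \<epsilon>) * (B / (2 * ln x))"
        using x(3) unfolding K_def by (simp only: distrib_right)
      then have "real n * (x powr (- \<delta>) + x powr (- 1 / 2) + K) \<le> real n * ((1 + \<epsilon>) * (B / (2 * ln x)))"
        using n by (intro mult_left_mono) auto
      moreover fix X assume "X \<in> {X. real (chromatic_number {1..n} (H n \<union> {e \<in> vertex_pairs {1..n}. X e}))
        \<le> real n * (x powr (- \<delta>) + x powr (- 1 / 2) + K)}"
      ultimately show "real (chromatic_number {1..n} (H n \<union> {e \<in> vertex_pairs {1..n}. X e}))
        \<le> (1 + \<epsilon>) * (real n * B / (2 * ln x))" by (simp add: mult_ac)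
    qed simp
    finally show ?case
      unfolding k_def[symmetric] ln_x
      by (simp add: pert_def gnp_def x_def[symmetric] B_def vimage_def)
  qed
  have "((\<lambda>x::nat. 1 - real x powr (- 1 / 2)) \<longlongrightarrow> 1) sequentially" by real_asymp
  then have "((\<lambda>n. 1 - real (\<beta> n) powr (- 1 / 2)) \<longlongrightarrow> 1) sequentially"
    using assms(4) by (rule filterlim_compose)
  then show ?thesis
    by (rule tendsto_sandwich[OF lower _ _ tendsto_const, rotated 1]) simp
qed

end
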